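(* Let $T$ be a tree with $ex(T)=1$. Let $v$ be the exterior major vertex of $T$ and let $\ell_1,\ell_2,\ldots,\ell_a$ be the terminal vertices of $v$ in $T$ (so $a\ge3$). Suppose that $d(v,\ell_1)\le d(v,\ell_2)\le\cdots\le d(v,\ell_a)$. Then $\kappa(T)=d(\ell_1,\ell_2)$, and (a) if $d(v,\ell_1)=d(v,\ell_2)$, then $\dim_f^k(T)=k\dim_f(T)=\frac{ka}{2}$ for every real $k\in[1,\kappa(T)]$; (b) if $d(v,\ell_1)<d(v,\ell_2)$, then $$\dim_f^k(T)=\begin{cases}\frac{ka}{2} & \text{for } k\in[1,2d(v,\ell_1)],\\ (a-1)k-(a-2)d(v,\ell_1) & \text{for } k\in(2d(v,\ell_1),\kappa(T)].\end{cases}$$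
   Context: All graphs are finite, simple and undirected. For a connected graph $G$ with at least two vertices, $d(x,y)$ is the length of a shortest path between $x$ and $y$. For distinct $x,y\in V(G)$, let $R\{x,y\}=\{z\in V(G): d(x,z)\neq d(y,z)\}$, and let $\kappa(G)=\min\{|R\{x,y\}|: x\neq y,\ x,y\in V(G)\}$. For a function $g$ on $V(G)$ and $U\subseteq V(G)$, write $g(U)=\sum_{s\in U}g(s)$. For a real number $k\in[1,\kappa(G)]$, a function $g:V(G)\to[0,1]$ is a $k$-resolving function of $G$ if $g(R\{x,y\})\ge k$ for any two distinct vertices $x,y\in V(G)$; the fractional $k$-metric dimension is $\dim_f^k(G)=\min\{g(V(G)): g \text{ is a } k\text{-resolving function of } G\}$. The fractional metric dimension is $\dim_f(G)=\dim_f^1(G)$. A leaf is a vertex of degree one; a major vertex is a vertex of degree at least three. A leaf $u$ is a terminal vertex of a major vertex $v$ if $d(u,v)<d(u,w)$ for every other major vertex $w$. A major vertex having at least one terminal vertex is an exterior major vertex; $ex(T)$ is the number of exterior major vertices of $T$. *)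

theory Defs
  imports Complex_Main "Graph_Theory.Graph_Theory"
begin

text \<open>
  A finite simple undirected graph is a \<^locale>\<open>pair_graph\<close>: a finite, symmetric,
  irreflexive set of pairs on a finite vertex set, each undirected edge being represented by its
  two orientations. The predicate \<^const>\<open>Digraph_Component.tree\<close> is not usable for such
  graphs, since there the closed walk $a,b,a$ along a single edge counts as a cycle; cycles of an
  undirected simple graph are the cycles of length at least three.
\<close>

definition undirected_tree :: "'a pair_pre_digraph \<Rightarrow> bool" where
  "undirected_tree G \<longleftrightarrow>
     pair_graph G \<and> Digraph_Component.connected (with_proj G) \<and>
     \<not> (\<exists>p. pre_digraph.cycle (with_proj G) p \<and> length p \<ge> 3)"

definition gdist :: "'a pair_pre_digraph \<Rightarrow> 'a \<Rightarrow> 'a \<Rightarrow> nat" where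
  "gdist G x y = (LEAST n. \<exists>p. pre_digraph.apath (with_proj G) x p y \<and> length p = n)"

text \<open>In a symmetric digraph the out-degree is the degree of the underlying undirected graph.\<close>

definition deg :: "'a pair_pre_digraph \<Rightarrow> 'a \<Rightarrow> nat" where
  "deg G v = out_degree (with_proj G) v"

definition resolving_set :: "'a pair_pre_digraph \<Rightarrow> 'a \<Rightarrow> 'a \<Rightarrow> 'a set" where
  "resolving_set G x y = {z \<in> pverts G. gdist G x z \<noteq> gdist G y z}"

definition kappa :: "'a pair_pre_digraph \<Rightarrow> nat" where
  "kappa G = Min {card (resolving_set G x y) | x y. x \<in> pverts G \<and> y \<in> pverts G \<and> x \<noteq> y}"

definition k_resolving_function :: "'a pair_pre_digraph \<Rightarrow> real \<Rightarrow> ('a \<Rightarrow> real) \<Rightarrow> bool" where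
  "k_resolving_function G k g \<longleftrightarrow>
     (\<forall>x\<in>pverts G. g x \<in> {0..1}) \<and>
     (\<forall>x\<in>pverts G. \<forall>y\<in>pverts G. x \<noteq> y \<longrightarrow> (\<Sum>s\<in>resolving_set G x y. g s) \<ge> k)"

text \<open>
  \<open>LEAST\<close> on the reals specifies an actual minimum: an equation for \<open>frac_metric_dim\<close>
  can only be derived by showing that the minimum is attained.
\<close>

definition frac_metric_dim :: "'a pair_pre_digraph \<Rightarrow> real \<Rightarrow> real" where
  "frac_metric_dim G k =
     (LEAST m. \<exists>g. k_resolving_function G k g \<and> m = (\<Sum>s\<in>pverts G. g s))"

definition leaf :: "'a pair_pre_digraph \<Rightarrow> 'a \<Rightarrow> bool" where
  "leaf G u \<longleftrightarrow> u \<in> pverts G \<and> deg G u = 1"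

definition major_vertex :: "'a pair_pre_digraph \<Rightarrow> 'a \<Rightarrow> bool" where
  "major_vertex G v \<longleftrightarrow> v \<in> pverts G \<and> deg G v \<ge> 3"

definition terminal_vertex :: "'a pair_pre_digraph \<Rightarrow> 'a \<Rightarrow> 'a \<Rightarrow> bool" where
  "terminal_vertex G v u \<longleftrightarrow>
     major_vertex G v \<and> leaf G u \<and>
     (\<forall>w. major_vertex G w \<and> w \<noteq> v \<longrightarrow> gdist G u v < gdist G u w)"

definition exterior_major_vertex :: "'a pair_pre_digraph \<Rightarrow> 'a \<Rightarrow> bool" where
  "exterior_major_vertex G v \<longleftrightarrow> major_vertex G v \<and> (\<exists>u. terminal_vertex G v u)"

definition ex_major :: "'a pair_pre_digraph \<Rightarrow> nat" where
  "ex_major G = card {v. exterior_major_vertex G v}"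

end

theory Submission
  imports Defs
begin

text \<open>
  Root \<open>T\<close> at \<open>v\<close>. A major vertex other than \<open>v\<close> and farthest from \<open>v\<close> would be exterior, so
  \<open>v\<close> is the only major vertex and \<open>T\<close> is a spider: \<open>v\<close> together with disjoint legs, one for
  each leaf \<open>u\<close>, of \<open>d(v,u)\<close> vertices. Every set \<open>R{x,y}\<close> contains two of the legs, and for any two
  legs it is their union when \<open>x\<close> and \<open>y\<close> are their vertices adjacent to \<open>v\<close>. This yields
  \<open>\<kappa>(T)\<close>, and \<open>k\<close>-resolving functions become leg weights \<open>s u \<in> [0, d(v,u)]\<close> with
  \<open>s u + s w \<ge> k\<close> for \<open>u \<noteq> w\<close>. For each of the \<open>a\<close> legs \<open>m\<close> the total weight is at least
  \<open>s m + (a - 1) (k - s m)\<close>; take \<open>m\<close> to be the shortest leg if \<open>k > 2 d(v,l 1)\<close>, and a leg with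
  \<open>s m < k / 2\<close> (if there is one) otherwise.
\<close>

section \<open>Maxima on finite sets, and sums under pairwise constraints\<close>

lemma ex_max_on_finite:
  fixes f :: "'b \<Rightarrow> nat"
  assumes "finite S" "S \<noteq> {}"
  obtains x where "x \<in> S" "\<And>y. y \<in> S \<Longrightarrow> f y \<le> f x"
proof -
  have "Max (f ` S) \<in> f ` S" using assms by simp
  then obtain x where "x \<in> S" "f x = Max (f ` S)" by auto
  then show ?thesis using that assms by simp
qed

text \<open>Each index other than \<open>m\<close> contributes at least \<open>k - s m\<close>. The
  bound is arranged by \<open>s m\<close> to show that it does not increase with \<open>s m\<close>
  once \<open>I\<close> has two elements.\<close>

lemma sum_lower_bound:
  fixes s :: "'b \<Rightarrow> real"
  assumes "finite I" "m \<in> I" "\<And>i. i \<in> I \<Longrightarrow> i \<noteq> m \<Longrightarrow> k \<le> s i + s m"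
  shows "(real (card I) - 1) * k - (real (card I) - 2) * s m \<le> sum s I"
proof -
  have c: "real (card (I - {m})) = real (card I) - 1"
    using assms(1,2) card_Diff_singleton[of m I] card_gt_0_iff[of I] by auto
  have "(real (card I) - 1) * (k - s m) \<le> sum s (I - {m})"
    using sum_bounded_below[of "I - {m}" "k - s m" s] assms(3) c by (simp add: algebra_simps)
  then show ?thesis
    using sum.remove[OF assms(1,2), of s] by (simp add: algebra_simps)
qed

text \<open>If some \<open>s m\<close> is below \<open>k / 2\<close>, the bound of
  \<open>sum_lower_bound\<close> is at least its value at \<open>s m = k / 2\<close>, which is
  \<open>k * card I / 2\<close>.\<close>

lemma half_sum_lower_bound:
  fixes s :: "'b \<Rightarrow> real"
  assumes "finite I" "2 \<le> card I"
    and "\<And>i j. i \<in> I \<Longrightarrow> j \<in> I \<Longrightarrow> i \<noteq> j \<Longrightarrow> k \<le> s i + s j"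
  shows "k * real (card I) / 2 \<le> sum s I"
proof (cases "\<forall>i \<in> I. k / 2 \<le> s i")
  case True
  then show ?thesis using sum_bounded_below[of I "k / 2" s] by (simp add: mult.commute)
next
  case False
  then obtain m where m: "m \<in> I" "s m < k / 2" by force
  have "(real (card I) - 2) * s m \<le> (real (card I) - 2) * (k / 2)"
    using assms(2) m by (intro mult_left_mono) auto
  moreover have "(real (card I) - 1) * k - (real (card I) - 2) * s m \<le> sum s I"
    using assms m by (intro sum_lower_bound) auto
  ultimately show ?thesis by (simp add: algebra_simps)
qed

lemma resolving_set_commute: "resolving_set G x y = resolving_set G y x"
  by (auto simp: resolving_set_def)

text \<open>Cutting out cycles only drops arcs. As \<open>gdist\<close> minimises over paths, this
  lets every walk bound it from above.\<close>

lemma (in wf_digraph) length_awalk_to_apath_le: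
  assumes "awalk u p v"
  shows "length (awalk_to_apath p) \<le> length p"
  using assms
proof (induct rule: awalk_to_apath_induct)
  case (path p)
  then have "awalk_to_apath p = p"
    by (auto simp: awalk_to_apath.simps)
  then show ?case by simp
next
  case (decomp p q r s)
  then have "awalk_to_apath p = awalk_to_apath (q @ s)" "p = q @ r @ s"
    using step_awalk_to_apath awalk_cyc_decompE by metis+
  then show ?case using decomp by simp
qed

section \<open>Distances in trees\<close>

locale finite_tree =
  fixes T :: "'a pair_pre_digraph"
  assumes undirected_tree: "undirected_tree T"

sublocale finite_tree \<subseteq> pair_graph T
  using undirected_tree by (simp add: undirected_tree_def)

context finite_tree
begin

abbreviation "V \<equiv> pverts T"
abbreviation "d \<equiv> gdist T"

lemma ex_apath:
  assumes "x \<in> V" "y \<in> V"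
  shows "\<exists>p. apath x p y"
proof -
  have "x \<rightarrow>\<^sup>*\<^bsub>mk_symmetric (with_proj T)\<^esub> y"
    using undirected_tree assms
    by (auto simp: undirected_tree_def connected_def)
  then have "x \<rightarrow>\<^sup>*\<^bsub>with_proj T\<^esub> y"
    by (simp add: reachable_mk_symmetric_eq sym_arcs)
  then show ?thesis by (simp add: reachable_apath)
qed

lemma gdist_apath:
  assumes "x \<in> V" "y \<in> V"
  shows "\<exists>p. apath x p y \<and> length p = d x y"
  unfolding gdist_def by (rule LeastI_ex) (use ex_apath[OF assms] in blast)

lemma gdist_le_length:
  assumes "awalk x p y"
  shows "d x y \<le> length p"
proof -
  have "d x y \<le> length (awalk_to_apath p)"
    unfolding gdist_def by (rule Least_le) (use apath_awalk_to_apath[OF assms] in blast)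
  then show ?thesis using length_awalk_to_apath_le[OF assms] by simp
qed

lemma gdist_awalk:
  assumes "x \<in> V" "y \<in> V"
  obtains p where "awalk x p y" "length p = d x y"
  using gdist_apath[OF assms] by (auto simp: apath_def)

lemma gdist_refl [simp]: "x \<in> V \<Longrightarrow> d x x = 0"
  using gdist_le_length[of x "[]" x] by (simp add: awalk_Nil_iff)

lemma gdist_eq_0_iff [simp]:
  assumes "x \<in> V" "y \<in> V"
  shows "d x y = 0 \<longleftrightarrow> x = y"
proof
  assume "d x y = 0"
  then obtain p where "awalk x p y" "p = []" using gdist_awalk[OF assms] by auto
  then show "x = y" by (simp add: awalk_Nil_iff)
qed (use assms in simp)

lemma gdist_triangle:
  assumes "x \<in> V" "y \<in> V" "z \<in> V"
  shows "d x z \<le> d x y + d y z"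
proof -
  obtain p q where "awalk x p y" "length p = d x y" "awalk y q z" "length q = d y z"
    using gdist_awalk assms by metis
  then show ?thesis using gdist_le_length[of x "p @ q" z] awalk_appendI by force
qed

lemma length_rev_path [simp]: "length (rev_path p) = length p"
  by (induct p) auto

lemma gdist_sym:
  assumes "x \<in> V" "y \<in> V"
  shows "d x y = d y x"
proof -
  have "d y x \<le> d x y" if "x \<in> V" "y \<in> V" for x y
    using gdist_awalk[OF that] gdist_le_length awalk_rev_path length_rev_path by metis
  then show ?thesis using assms by (simp add: antisym)
qed

lemma gdist_arc:
  assumes "(x, y) \<in> parcs T"
  shows "d x y = 1"
proof -
  have "awalk x [(x, y)] y" using assms by (auto simp: awalk_Cons_iff awalk_Nil_iff in_arcsD2)
  then have "d x y \<le> 1" using gdist_le_length by force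
  moreover have "x \<noteq> y" using assms no_loops' by blast
  ultimately show ?thesis using assms gdist_eq_0_iff in_arcsD1 in_arcsD2
    by (metis le_neq_implies_less less_one)
qed

lemma gdist_arc_le:
  assumes "r \<in> V" "(x, y) \<in> parcs T"
  shows "d r y \<le> d r x + 1"
  using gdist_triangle[of r x y] gdist_arc assms in_arcsD1 in_arcsD2 by metis

lemma gdist_predecessor:
  assumes "x \<in> V" "y \<in> V" "x \<noteq> y"
  obtains z where "(z, y) \<in> parcs T" "d x z + 1 = d x y"
proof -
  obtain p where p: "awalk x p y" "length p = d x y" using gdist_awalk[OF assms(1,2)] .
  with assms have "p \<noteq> []" by auto
  then obtain q e where q: "p = q @ [e]" by (metis rev_exhaust)
  with p have e: "awalk x q (fst e)" "e \<in> parcs T" "snd e = y"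
    by (auto simp: awalk_Cons_iff awalk_Nil_iff)
  then have "(fst e, y) \<in> parcs T" by (metis prod.collapse)
  moreover have "d x (fst e) \<le> length q" using gdist_le_length e by blast
  then have "d x (fst e) + 1 = d x y"
    using gdist_arc_le[OF assms(1) \<open>(fst e, y) \<in> parcs T\<close>] p q by simp
  ultimately show ?thesis using that by blast
qed

section \<open>Reachability after deletion of a vertex\<close>

definition avoiding :: "'a \<Rightarrow> ('a \<times> 'a) set" where
  "avoiding x = {(u, w) \<in> parcs T. u \<noteq> x \<and> w \<noteq> x}"

lemma awalk_avoiding:
  assumes "(p, q) \<in> (avoiding x)\<^sup>*" "p \<in> V"
  shows "\<exists>W. awalk p W q \<and> set W \<subseteq> avoiding x"
  using assms
proof (induct rule: rtrancl_induct)
  case base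
  then show ?case by (intro exI[of _ "[]"]) (simp add: awalk_Nil_iff)
next
  case (step y z)
  then obtain W where "awalk p W y" "set W \<subseteq> avoiding x" by blast
  moreover have "awalk y [(y, z)] z"
    using step by (auto simp: awalk_Cons_iff awalk_Nil_iff in_arcsD2 avoiding_def)
  ultimately show ?case using step awalk_appendI
    by (intro exI[of _ "W @ [(y, z)]"]) auto
qed

text \<open>Acyclicity enters here: a path between two different neighbours of \<open>x\<close> that
  avoids \<open>x\<close> closes up through \<open>x\<close> to a cycle.\<close>

lemma avoiding_imp_eq:
  assumes "(x, p) \<in> parcs T" "(x, q) \<in> parcs T" "(p, q) \<in> (avoiding x)\<^sup>*"
  shows "p = q"
proof (rule ccontr)
  assume "p \<noteq> q"
  have pV: "p \<in> V" "x \<noteq> p" using assms in_arcsD2 no_loops' by blast+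
  obtain W where W: "awalk p W q" "set W \<subseteq> avoiding x"
    using awalk_avoiding[OF assms(3) pV(1)] by blast
  define P where "P = awalk_to_apath W"
  have P: "apath p P q" "set P \<subseteq> avoiding x"
    using W apath_awalk_to_apath awalk_to_apath_subset unfolding P_def by blast+
  have "P \<noteq> []" using P \<open>p \<noteq> q\<close> by (auto simp: apath_def awalk_Nil_iff)
  have x: "x \<notin> set (awalk_verts p P)"
    using P pV by (subst set_awalk_verts[of p P q]) (auto simp: apath_def avoiding_def)
  have qx: "awalk q [(q, x)] x"
    using assms arcs_symmetric in_arcsD1 by (auto simp: awalk_Cons_iff awalk_Nil_iff)
  have aw: "awalk p (P @ [(q, x)]) x"
    using P qx awalk_appendI by (auto simp: apath_def)
  have vs: "awalk_verts p (P @ [(q, x)]) = awalk_verts p P @ [x]"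
    using awalk_verts_append[OF aw] by simp
  have "cycle ((x, p) # P @ [(q, x)])"
    unfolding cycle_def
    using aw vs P x assms(1) in_arcsD1
    by (intro exI[of _ x]) (auto simp: apath_def awalk_Cons_iff)
  \<comment> \<open>At least one arc in \<open>P\<close> rules out the closed walk that runs back
    and forth along a single edge.\<close>
  moreover have "length ((x, p) # P @ [(q, x)]) \<ge> 3"
    using \<open>P \<noteq> []\<close> by (cases P) auto
  ultimately show False using undirected_tree unfolding undirected_tree_def by blast
qed

text \<open>On a shortest way back from \<open>p\<close> to \<open>r\<close> every later vertex is
  strictly closer to \<open>r\<close> than \<open>p\<close>, hence than \<open>x\<close>.\<close>

lemma avoiding_from_root:
  assumes "r \<in> V" "p \<in> V" "p \<noteq> x" "d r p \<le> d r x"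
  shows "(r, p) \<in> (avoiding x)\<^sup>*"
  using assms
proof (induct "d r p" arbitrary: p)
  case 0
  then show ?case by simp
next
  case (Suc n)
  then have "r \<noteq> p" using gdist_refl by force
  then obtain z where z: "(z, p) \<in> parcs T" "d r z + 1 = d r p"
    using gdist_predecessor Suc by blast
  then have "z \<noteq> x" "z \<in> V" using Suc in_arcsD1 by auto
  then have "(r, z) \<in> (avoiding x)\<^sup>*" using Suc z by simp
  moreover have "(z, p) \<in> avoiding x" using z Suc \<open>z \<noteq> x\<close> by (simp add: avoiding_def)
  ultimately show ?case by simp
qed

lemma sym_avoiding: "sym (avoiding x)"
  unfolding sym_def avoiding_def using arcs_symmetric by blast

text \<open>Both neighbours reach \<open>r\<close> without passing through \<open>x\<close>, hence
  reach each other. The non-strict inequalities also exclude edges between vertices of equal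
  depth.\<close>

lemma closer_neighbour_unique:
  assumes "r \<in> V" "(x, p) \<in> parcs T" "(x, q) \<in> parcs T" "d r p \<le> d r x" "d r q \<le> d r x"
  shows "p = q"
proof -
  have "(r, p) \<in> (avoiding x)\<^sup>*" "(r, q) \<in> (avoiding x)\<^sup>*"
    using assms in_arcsD2 no_loops' by (blast intro: avoiding_from_root)+
  then have "(p, q) \<in> (avoiding x)\<^sup>*"
    by (meson sym_avoiding sym_rtrancl symD rtrancl_trans)
  then show ?thesis using avoiding_imp_eq assms by blast
qed

lemma deg_eq_card: "deg T x = card {y. (x, y) \<in> parcs T}"
proof -
  have "bij_betw snd (out_arcs (with_proj T) x) {y. (x, y) \<in> parcs T}"
    by (rule bij_betwI[where g = "\<lambda>y. (x, y)"]) (auto simp: out_arcs_def)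
  then show ?thesis by (simp add: deg_def out_degree_def bij_betw_same_card)
qed

lemma finite_neighbours [simp]: "finite {y. (x, y) \<in> parcs T}"
  by (rule finite_subset[OF _ pair_finite_verts]) (auto simp: in_arcsD2)

end

section \<open>Rooted trees\<close>

locale rooted_tree = finite_tree +
  fixes r :: 'a
  assumes root_in_V [simp]: "r \<in> V"
begin

text \<open>For a vertex other than \<open>r\<close> the choice is unique by
  \<open>closer_neighbour_unique\<close>; at \<open>r\<close> the value is unspecified.\<close>

definition par :: "'a \<Rightarrow> 'a" where
  "par x = (SOME y. (y, x) \<in> parcs T \<and> d r y + 1 = d r x)"

lemma
  assumes "x \<in> V" "x \<noteq> r"
  shows par_arc: "(par x, x) \<in> parcs T" and depth_par: "d r x = d r (par x) + 1"
    and par_in_V: "par x \<in> V"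
proof -
  have "(par x, x) \<in> parcs T \<and> d r (par x) + 1 = d r x"
    unfolding par_def by (rule someI_ex) (use gdist_predecessor[of r x] assms in auto)
  then show "(par x, x) \<in> parcs T" "d r x = d r (par x) + 1" "par x \<in> V"
    using in_arcsD1 by auto
qed

lemma eq_par_if_closer:
  assumes "(x, y) \<in> parcs T" "d r y \<le> d r x"
  shows "x \<noteq> r \<and> y = par x"
proof -
  have V: "x \<in> V" "y \<in> V" "x \<noteq> y" using assms in_arcsD1 in_arcsD2 no_loops' by blast+
  have "x \<noteq> r" using assms V by auto
  moreover have "y = par x"
  proof (rule closer_neighbour_unique)
    show "(x, par x) \<in> parcs T" using par_arc V \<open>x \<noteq> r\<close> arcs_symmetric by blast
    show "d r (par x) \<le> d r x" using depth_par[of x] V \<open>x \<noteq> r\<close> by simp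
  qed (use assms in auto)
  ultimately show ?thesis by simp
qed

text \<open>One end of an edge is no farther from \<open>r\<close> than the other, so it is the
  parent of the other end.\<close>

lemma arc_cases:
  assumes "(x, y) \<in> parcs T"
  obtains "x \<noteq> r" "y = par x" | "y \<noteq> r" "x = par y"
  using eq_par_if_closer[of x y] eq_par_if_closer[of y x] arcs_symmetric assms
  by (meson linear)

lemma par_eq_imp_child:
  assumes "x \<in> V" "y \<in> V" "y \<noteq> r" "par y = x"
  shows "(x, y) \<in> parcs T" "d r y = d r x + 1"
  using assms par_arc depth_par by blast+

lemma neighbours_eq:
  assumes "x \<in> V" "x \<noteq> r"
  shows "{y. (x, y) \<in> parcs T} = insert (par x) {y \<in> V. y \<noteq> r \<and> par y = x}"
  using assms par_arc arcs_symmetric in_arcsD2 by (auto elim: arc_cases)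

lemma depth_pos: "x \<in> V \<Longrightarrow> x \<noteq> r \<Longrightarrow> 1 \<le> d r x"
  using depth_par by simp

text \<open>The degree is the number of children plus one for the parent, which by its depth is not
  a child as well.\<close>

lemma leaf_iff_childless:
  assumes "x \<in> V" "x \<noteq> r"
  shows "leaf T x \<longleftrightarrow> {y \<in> V. y \<noteq> r \<and> par y = x} = {}"
proof -
  have "par x \<notin> {y \<in> V. y \<noteq> r \<and> par y = x}"
    using assms depth_par[of x] depth_par[of "par x"] by auto
  moreover have "finite {y \<in> V. y \<noteq> r \<and> par y = x}" by (simp add: pair_finite_verts)
  ultimately have "deg T x = card {y \<in> V. y \<noteq> r \<and> par y = x} + 1"
    using assms by (simp add: deg_eq_card neighbours_eq)
  then show ?thesis
    using assms \<open>finite _\<close> by (simp add: leaf_def)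
qed

text \<open>If \<open>x\<close> lies on a shortest path from \<open>r\<close> to \<open>u\<close>,
  so does the last vertex \<open>z\<close> before \<open>u\<close> on a shortest path from
  \<open>x\<close>; being closer to \<open>r\<close>, it is the parent of \<open>u\<close>.\<close>

lemma geodesic_ancestor:
  assumes "x \<in> V" "u \<in> V" "d r x + d x u = d r u"
  shows "x = (par ^^ d x u) u"
  using assms
proof (induct "d x u" arbitrary: u)
  case 0
  then show ?case by simp
next
  case (Suc n)
  have "d x u \<noteq> 0" using Suc.hyps(2) by linarith
  then have "x \<noteq> u" "d r u \<noteq> 0" using Suc.prems by (metis gdist_refl, linarith)
  then obtain z where z: "(z, u) \<in> parcs T" "d x z + 1 = d x u"
    using gdist_predecessor[OF Suc.prems(1,2)] by blast
  have zV: "z \<in> V" using z in_arcsD1 by blast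
  have "d r z \<le> d r x + d x z" using gdist_triangle Suc zV by simp
  moreover have "d r u \<le> d r z + 1" using gdist_arc_le z by simp
  ultimately have dz: "d r z + 1 = d r u" "d r x + d x z = d r z" using z Suc by linarith+
  then have "z = par u" using eq_par_if_closer[of u z] z arcs_symmetric by auto
  moreover have "x = (par ^^ d x z) z" using Suc dz z zV by simp
  ultimately show ?case using z by (metis Suc_eq_plus1 comp_apply funpow_Suc_right)
qed

text \<open>The witness is a major vertex farthest from the root, and its terminal vertex is one of its
  deepest descendants \<open>u\<close>: a major vertex at least as close to \<open>u\<close> would be an ancestor of
  \<open>u\<close> at the same depth.\<close>

lemma ex_exterior_major_vertex:
  assumes "major_vertex T w0" "w0 \<noteq> r"
  shows "\<exists>w. w \<noteq> r \<and> exterior_major_vertex T w"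
proof -
  let ?S = "{w. major_vertex T w \<and> w \<noteq> r}"
  have "finite ?S" by (rule finite_subset[OF _ pair_finite_verts]) (auto simp: major_vertex_def)
  moreover have "?S \<noteq> {}" using assms by blast
  ultimately obtain w where "w \<in> ?S" and max: "\<And>w'. w' \<in> ?S \<Longrightarrow> d r w' \<le> d r w"
    using ex_max_on_finite[of ?S "d r"] by blast
  then have w: "major_vertex T w" "w \<noteq> r" by auto
  have w_max: "d r w' \<le> d r w" if "major_vertex T w'" for w'
    using max[of w'] that by (cases "w' = r") auto
  have wV: "w \<in> V" "3 \<le> deg T w" using w by (auto simp: major_vertex_def)
  \<comment> \<open>The descendants of \<open>w\<close>, including \<open>w\<close>: the vertices
    that have a shortest path from \<open>r\<close> through \<open>w\<close>.\<close>
  let ?D = "{u \<in> V. d r w + d w u = d r u}"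
  have "finite ?D" by (simp add: pair_finite_verts)
  moreover have "w \<in> ?D" using wV by simp
  ultimately obtain u where uD: "u \<in> ?D" and u_max: "\<And>y. y \<in> ?D \<Longrightarrow> d w y \<le> d w u"
    using ex_max_on_finite[of ?D "d w"] by blast
  then have u: "u \<in> V" "d r w + d w u = d r u" by auto
  have child: "y \<in> ?D \<and> d w y = d w x + 1"
    if "x \<in> ?D" "y \<in> V" "y \<noteq> r" "par y = x" for x y
  proof -
    have x: "(x, y) \<in> parcs T" "d r y = d r x + 1" using par_eq_imp_child that by auto
    have "d w y \<le> d w x + 1" using gdist_arc_le x wV by blast
    moreover have "d r y \<le> d r w + d w y" using gdist_triangle that wV by simp
    moreover have "d r w + d w x = d r x" using that by blast
    ultimately have "d w y = d w x + 1" "d r w + d w y = d r y" using x by linarith+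
    then show ?thesis using that by blast
  qed
  have "leaf T u"
  proof -
    have "1 \<le> d r u" using u(2) depth_pos[OF wV(1) w(2)] by linarith
    then have "u \<noteq> r" by force
    moreover have False if "y \<in> V" "y \<noteq> r" "par y = u" for y
      using child[OF uD that] u_max[of y] by linarith
    then have "{y \<in> V. y \<noteq> r \<and> par y = u} = {}" by blast
    ultimately show ?thesis using leaf_iff_childless u by simp
  qed
  moreover have "d u w < d u w'" if w': "major_vertex T w'" "w' \<noteq> w" for w'
  proof -
    have V: "w' \<in> V" using w' by (simp add: major_vertex_def)
    have "d r u \<le> d r w' + d w' u" using gdist_triangle u V by simp
    moreover have "d r w' \<le> d r w" using w_max w' by blast
    moreover have "d r w' + d w' u \<noteq> d r u \<or> d w' u \<noteq> d w u"
      using geodesic_ancestor[OF V u(1)] geodesic_ancestor[OF wV(1) u] w'(2) by metis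
    ultimately have "d w u < d w' u" using u by linarith
    then show ?thesis using gdist_sym u V wV by simp
  qed
  ultimately have "terminal_vertex T w u" using w by (simp add: terminal_vertex_def)
  then show ?thesis using w by (auto simp: exterior_major_vertex_def)
qed

end

section \<open>Spiders\<close>

locale spider = rooted_tree +
  assumes major_root: "major_vertex T r"
    and major_imp_root: "major_vertex T w \<Longrightarrow> w = r"
begin

text \<open>Two children and the parent would make \<open>x\<close> a second major vertex.\<close>

lemma child_unique:
  assumes "x \<in> V" "x \<noteq> r" "y \<in> V" "y \<noteq> r" "par y = x" "z \<in> V" "z \<noteq> r" "par z = x"
  shows "y = z"
proof (rule ccontr)
  assume "y \<noteq> z"
  have "d r x = d r (par x) + 1" "d r y = d r x + 1" "d r z = d r x + 1"
    using depth_par assms by metis+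
  then have "par x \<noteq> y" "par x \<noteq> z" by auto
  then have "card {par x, y, z} = 3" using \<open>y \<noteq> z\<close> by simp
  moreover have "{par x, y, z} \<subseteq> {y. (x, y) \<in> parcs T}"
    using assms neighbours_eq by auto
  ultimately have "3 \<le> deg T x"
    unfolding deg_eq_card by (metis card_mono finite_neighbours)
  then show False using major_imp_root assms by (auto simp: major_vertex_def)
qed

lemma leaf_neq_root: "leaf T u \<Longrightarrow> u \<noteq> r"
  using major_root by (auto simp: leaf_def major_vertex_def)

lemma leaf_in_V: "leaf T u \<Longrightarrow> u \<in> V"
  by (simp add: leaf_def)

lemma terminal_iff_leaf: "terminal_vertex T r u \<longleftrightarrow> leaf T u"
  unfolding terminal_vertex_def using major_root major_imp_root by blast

text \<open>For \<open>x \<noteq> r\<close> this is the ancestor of \<open>x\<close> at depth one,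
  which names the component of \<open>T\<close> without \<open>r\<close> containing
  \<open>x\<close>. Truncated subtraction gives \<open>branch r = r\<close>.\<close>

definition branch :: "'a \<Rightarrow> 'a" where
  "branch x = (par ^^ (d r x - 1)) x"

lemma branch_par:
  assumes "x \<in> V" "x \<noteq> r" "par x \<noteq> r"
  shows "branch (par x) = branch x"
proof -
  have "d r x - 1 = Suc (d r (par x) - 1)"
    using depth_par[OF assms(1,2)] depth_pos[OF par_in_V assms(3)] assms by simp
  then show ?thesis by (simp add: branch_def funpow_Suc_right del: funpow.simps)
qed

lemma branch_nbr_root:
  assumes "(r, c) \<in> parcs T"
  shows "branch c = c"
  using gdist_arc[OF assms] by (simp add: branch_def)

lemma branch_root_arc:
  assumes "x \<in> V" "x \<noteq> r"
  shows "(r, branch x) \<in> parcs T"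
  using assms
proof (induct "d r x" arbitrary: x)
  case 0
  then show ?case by simp
next
  case (Suc n)
  show ?case
  proof (cases "par x = r")
    case True
    then have "(r, x) \<in> parcs T" using par_arc Suc by metis
    then show ?thesis by (simp add: branch_nbr_root)
  next
    case False
    have "n = d r (par x)" using Suc.hyps(2) depth_par[OF Suc.prems] by simp
    then show ?thesis
      using Suc.hyps(1)[of "par x"] False par_in_V branch_par Suc.prems by simp
  qed
qed

text \<open>At depth one a vertex is its own branch. Deeper down, the parents agree by induction and
  have only one child.\<close>

lemma branch_depth_inj:
  assumes "x \<in> V" "x \<noteq> r" "y \<in> V" "y \<noteq> r" "branch x = branch y" "d r x = d r y"
  shows "x = y"
  using assms
proof (induct "d r x" arbitrary: x y)
  case 0
  then show ?case by simp
next
  case (Suc n)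
  have dp: "d r (par x) = n" "d r (par y) = n"
    using Suc.hyps(2) Suc.prems depth_par[of x] depth_par[of y] by simp_all
  have V: "par x \<in> V" "par y \<in> V" using Suc.prems par_in_V by blast+
  show ?case
  proof (cases "n = 0")
    case True
    then have "d r x = 1" "d r y = 1" using Suc.hyps(2) Suc.prems by simp_all
    then show ?thesis using Suc.prems by (simp add: branch_def)
  next
    case False
    then have nr: "par x \<noteq> r" "par y \<noteq> r" using dp by auto
    then have "branch (par x) = branch (par y)" using Suc.prems branch_par by simp
    then have "par x = par y" using Suc.hyps(1)[of "par x" "par y"] dp V nr by simp
    then show ?thesis using child_unique[OF V(1) nr(1)] Suc.prems(1-4) by metis
  qed
qed

lemma ex_in_branch:
  assumes "y \<in> V" "y \<noteq> r" "1 \<le> j" "j \<le> d r y"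
  shows "\<exists>x \<in> V. x \<noteq> r \<and> branch x = branch y \<and> d r x = j"
  using assms
proof (induct "d r y - j" arbitrary: y)
  case 0
  then show ?case by auto
next
  case (Suc n)
  have dp: "d r y = d r (par y) + 1" "par y \<in> V"
    using Suc.prems depth_par par_in_V by blast+
  have le: "n = d r (par y) - j" "j \<le> d r (par y)" using Suc.hyps(2) dp by linarith+
  then have "par y \<noteq> r" using Suc.prems(3) by auto
  then show ?case
    using Suc.hyps(1)[of "par y"] le Suc.prems dp(2) branch_par[of y] by simp
qed

text \<open>The vertex of this branch one level below \<open>x\<close> has a parent with the branch
  and depth of \<open>x\<close>, so this parent is \<open>x\<close>.\<close>

lemma ex_child_if_deeper:
  assumes "x \<in> V" "x \<noteq> r" "y \<in> V" "y \<noteq> r" "branch x = branch y" "d r x < d r y"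
  shows "\<exists>c \<in> V. c \<noteq> r \<and> par c = x"
proof -
  obtain c where c: "c \<in> V" "c \<noteq> r" "branch c = branch y" "d r c = d r x + 1"
    using ex_in_branch[of y "d r x + 1"] assms by auto
  have dp: "d r (par c) = d r x" "par c \<in> V"
    using c depth_par[of c] par_in_V[of c] by simp_all
  moreover have "par c \<noteq> r" using dp(1) depth_pos[OF assms(1,2)] by auto
  ultimately have "par c = x"
    using branch_depth_inj[of "par c" x] assms c branch_par[of c] by simp
  then show ?thesis using c by blast
qed

text \<open>A deeper vertex on the same branch would provide a child of \<open>u\<close>.\<close>

lemma leaf_deepest:
  assumes "leaf T u" "x \<in> V" "x \<noteq> r" "branch x = branch u"
  shows "d r x \<le> d r u"
proof (rule ccontr)
  assume "\<not> ?thesis"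
  then have "\<exists>c \<in> V. c \<noteq> r \<and> par c = u"
    using ex_child_if_deeper[of u x] leaf_neq_root leaf_in_V assms by simp
  then show False
    using leaf_iff_childless[of u] leaf_neq_root leaf_in_V assms(1) by blast
qed

lemma leaf_branch_inj:
  assumes "leaf T u" "leaf T w" "branch u = branch w"
  shows "u = w"
proof (rule branch_depth_inj)
  show "d r u = d r w"
    using leaf_deepest[of u w] leaf_deepest[of w u] leaf_neq_root leaf_in_V assms
    by (simp add: antisym)
qed (use assms leaf_neq_root leaf_in_V in simp_all)

text \<open>A deepest vertex of the branch has no child.\<close>

lemma ex_leaf_in_branch:
  assumes "(r, c) \<in> parcs T"
  shows "\<exists>u. leaf T u \<and> branch u = c"
proof -
  let ?S = "{x \<in> V. x \<noteq> r \<and> branch x = c}"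
  have "c \<in> ?S" using assms branch_nbr_root in_arcsD2 no_loops' by blast
  moreover have "finite ?S" by (simp add: pair_finite_verts)
  ultimately obtain u where u: "u \<in> ?S" "\<And>y. y \<in> ?S \<Longrightarrow> d r y \<le> d r u"
    using ex_max_on_finite[of ?S "d r"] by blast
  have "False" if y: "y \<in> V" "y \<noteq> r" "par y = u" for y
  proof -
    have "d r y = d r u + 1" using depth_par y by blast
    moreover have "y \<in> ?S" using y u(1) branch_par[of y] by simp
    ultimately show False using u(2)[of y] by simp
  qed
  then have "leaf T u" using leaf_iff_childless[of u] u(1) by blast
  then show ?thesis using u(1) by blast
qed

lemma bij_betw_branch_leaves:
  "bij_betw branch {u. leaf T u} {c. (r, c) \<in> parcs T}"
proof (rule bij_betw_imageI)
  show "inj_on branch {u. leaf T u}" using leaf_branch_inj by (auto intro: inj_onI)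
  show "branch ` {u. leaf T u} = {c. (r, c) \<in> parcs T}"
    using ex_leaf_in_branch branch_root_arc leaf_in_V leaf_neq_root by force
qed

text \<open>Leaves correspond to the neighbours of \<open>r\<close>, and \<open>r\<close> is a major
  vertex.\<close>

lemma card_leaves_ge_3: "3 \<le> card {u. leaf T u}"
  using bij_betw_same_card[OF bij_betw_branch_leaves] major_root
  by (simp add: major_vertex_def deg_eq_card)

text \<open>For a leaf \<open>u\<close> this is the path from \<open>r\<close> to \<open>u\<close>
  without \<open>r\<close>. Indexing by leaves makes \<open>d r u\<close> the length of the
  leg.\<close>

definition leg :: "'a \<Rightarrow> 'a set" where
  "leg u = {x \<in> V. x \<noteq> r \<and> branch x = branch u}"

text \<open>Depth numbers the vertices of the leg from 1 at the neighbour of \<open>r\<close> to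
  \<open>d r u\<close> at the leaf.\<close>

lemma card_leg:
  assumes "leaf T u"
  shows "card (leg u) = d r u"
proof -
  have "bij_betw (d r) (leg u) {1..d r u}"
  proof (rule bij_betw_imageI)
    show "inj_on (d r) (leg u)" using branch_depth_inj by (auto simp: leg_def intro: inj_onI)
    show "d r ` leg u = {1..d r u}"
    proof
      show "d r ` leg u \<subseteq> {1..d r u}" using leaf_deepest depth_pos assms by (auto simp: leg_def)
      show "{1..d r u} \<subseteq> d r ` leg u"
        using ex_in_branch[of u] leaf_in_V leaf_neq_root assms by (force simp: leg_def)
    qed
  qed
  then show ?thesis using bij_betw_same_card by fastforce
qed

lemma leg_cover:
  assumes "x \<in> V" "x \<noteq> r"
  obtains u where "leaf T u" "x \<in> leg u"
  using ex_leaf_in_branch[OF branch_root_arc[OF assms]] assms by (auto simp: leg_def)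

lemma leg_disjoint:
  assumes "leaf T u" "leaf T w" "x \<in> leg u" "x \<in> leg w"
  shows "u = w"
  using assms leaf_branch_inj by (simp add: leg_def)

text \<open>Climbing from \<open>z\<close> towards \<open>r\<close> stays on the leg and meets
  \<open>x\<close> at the depth of \<open>x\<close>. The additive form avoids truncated
  subtraction.\<close>

lemma gdist_same_leg_le:
  assumes "x \<in> leg u" "z \<in> leg u" "d r x \<le> d r z"
  shows "d x z + d r x \<le> d r z"
  using assms
proof (induct "d r z - d r x" arbitrary: z)
  case 0
  then have "d r x = d r z" by simp
  then have "x = z" using 0 branch_depth_inj[of x z] by (simp add: leg_def)
  then show ?case using 0 by (simp add: leg_def)
next
  case (Suc n)
  then have zV: "z \<in> V" "z \<noteq> r" "x \<in> V" "x \<noteq> r" by (auto simp: leg_def)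
  then have dp: "d r z = d r (par z) + 1" "par z \<in> V" "(par z, z) \<in> parcs T"
    using depth_par par_in_V par_arc by blast+
  have le: "n = d r (par z) - d r x" "d r x \<le> d r (par z)" using Suc.hyps(2) dp(1) by linarith+
  moreover have "1 \<le> d r x" using zV depth_pos by blast
  ultimately have "par z \<noteq> r" by auto
  then have "par z \<in> leg u" using Suc.prems(2) branch_par[of z] dp(2) by (simp add: leg_def)
  then have "d x (par z) + d r x \<le> d r (par z)" using Suc.hyps(1) Suc.prems(1) le by blast
  moreover have "d x z \<le> d x (par z) + 1" using gdist_arc_le dp zV by blast
  ultimately show ?case using dp by simp
qed

text \<open>The height function that decreases along the leg of \<open>x\<close> towards its leaf and increases
  along all other legs changes by one along each edge.\<close>

lemma height_le_gdist:
  assumes "x \<in> V" "x \<noteq> r" "z \<in> V"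
  shows "int (d r x) + (if z \<noteq> r \<and> branch z = branch x then - int (d r z) else int (d r z))
      \<le> int (d x z)" (is "?f z \<le> _")
  using assms
proof (induct "d x z" arbitrary: z)
  case 0
  then show ?case by simp
next
  case (Suc n)
  then have "x \<noteq> z" using Suc.hyps(2) by (metis gdist_refl nat.distinct(1))
  then obtain w where w: "(w, z) \<in> parcs T" "d x w + 1 = d x z"
    using gdist_predecessor[of x z] Suc.prems by blast
  then have wV: "w \<in> V" using in_arcsD1 by blast
  moreover have "n = d x w" using Suc.hyps(2) w(2) by linarith
  ultimately have "?f w \<le> int (d x w)" using Suc.hyps(1) Suc.prems by blast
  \<comment> \<open>The two cases of the height agree at \<open>r\<close>, where the depth is 0, so
    an edge at \<open>r\<close> is no exception.\<close>
  moreover have "?f z \<le> ?f w + 1"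
    using w(1)
  proof (cases rule: arc_cases)
    case 1
    then show ?thesis using depth_par[of w] branch_par[of w] wV by (cases "par w = r") auto
  next
    case 2
    then show ?thesis using depth_par[of z] branch_par[of z] Suc.prems by (cases "par z = r") auto
  qed
  ultimately show ?case using w by simp
qed

text \<open>The route through \<open>r\<close> gives the upper bound, the height function the lower
  one.\<close>

lemma gdist_distinct_legs:
  assumes "leaf T u" "leaf T w" "u \<noteq> w" "x \<in> leg u" "z \<in> leg w"
  shows "d x z = d r x + d r z"
proof -
  have "branch x \<noteq> branch z" using assms leaf_branch_inj by (auto simp: leg_def)
  moreover have V: "x \<in> V" "z \<in> V" "x \<noteq> r" using assms by (auto simp: leg_def)
  ultimately have "int (d r x) + int (d r z) \<le> int (d x z)"
    using height_le_gdist[of x z] by auto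
  moreover have "d x z \<le> d r x + d r z"
    using gdist_triangle[of x r z] gdist_sym[of x r] V by simp
  ultimately show ?thesis by simp
qed

end

section \<open>The fractional dimension of a spider\<close>

context spider
begin

abbreviation "leaves \<equiv> {u. leaf T u}"

lemma finite_leaves [simp]: "finite leaves"
  by (rule finite_subset[OF _ pair_finite_verts]) (auto simp: leaf_def)

lemma finite_leg [simp]: "finite (leg u)"
  by (rule finite_subset[OF _ pair_finite_verts]) (auto simp: leg_def)

lemma leg_subset_V: "leg u \<subseteq> V"
  by (auto simp: leg_def)

lemma leaf_depth_pos: "leaf T u \<Longrightarrow> 1 \<le> d r u"
  using depth_pos leaf_in_V leaf_neq_root by blast

lemma leg_Int_empty: "leaf T u \<Longrightarrow> leaf T w \<Longrightarrow> u \<noteq> w \<Longrightarrow> leg u \<inter> leg w = {}"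
  using leg_disjoint by blast

section \<open>Resolving sets of a spider\<close>

lemma ex_third_leaf: "\<exists>t. leaf T t \<and> t \<noteq> u \<and> t \<noteq> w"
proof (rule ccontr)
  assume "\<not> ?thesis"
  then have "leaves \<subseteq> {u, w}" by auto
  then have "card leaves \<le> card {u, w}" by (intro card_mono) auto
  also have "\<dots> \<le> 2" by (simp add: card_insert_if)
  finally show False using card_leaves_ge_3 by simp
qed

lemma gdist_other_leg:
  assumes "leaf T u" "leaf T t" "t \<noteq> u" "x = r \<or> x \<in> leg u" "z \<in> leg t"
  shows "d x z = d r x + d r z"
  using assms gdist_distinct_legs by auto

text \<open>From \<open>y\<close> a vertex \<open>z\<close> of \<open>leg u\<close> is reached
  through \<open>r\<close>. From \<open>x\<close> the way along the leg is at most the difference of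
  the depths, which is less than \<open>d r x + d r z\<close> as both depths are positive.\<close>

lemma own_leg_resolves:
  assumes "leaf T u" "leaf T w" "u \<noteq> w" "x \<in> leg u" "y \<in> leg w" "d r x \<le> d r y"
  shows "leg u \<subseteq> resolving_set T x y"
proof
  fix z assume z: "z \<in> leg u"
  have V: "x \<in> V" "z \<in> V" using assms z leg_subset_V by auto
  have pos: "1 \<le> d r x" "1 \<le> d r z" using assms(4) z depth_pos by (auto simp: leg_def)
  have "d y z = d r y + d r z" using gdist_distinct_legs assms z by metis
  moreover have "d x z < d r y + d r z"
  proof (cases "d r x \<le> d r z")
    case True
    then show ?thesis using gdist_same_leg_le[OF assms(4) z] pos by linarith
  next
    case False
    then have "d z x + d r z \<le> d r x" using gdist_same_leg_le[OF z assms(4)] by linarith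
    then show ?thesis using gdist_sym[OF V] pos assms(6) by linarith
  qed
  ultimately show "z \<in> resolving_set T x y" using V by (simp add: resolving_set_def)
qed

text \<open>Both distances to a vertex of \<open>leg t\<close> are measured through
  \<open>r\<close>, so they differ by the difference of the depths. The case \<open>u = w\<close> is
  included.\<close>

lemma other_leg_resolves:
  assumes "leaf T u" "leaf T w" "leaf T t" "t \<noteq> u" "t \<noteq> w"
    and "x = r \<or> x \<in> leg u" "y = r \<or> y \<in> leg w" "d r x \<noteq> d r y"
  shows "leg t \<subseteq> resolving_set T x y"
  using gdist_other_leg[of u t x] gdist_other_leg[of w t y] assms leg_subset_V
  by (auto simp: resolving_set_def)

text \<open>Let \<open>y\<close> be at least as deep as \<open>x\<close>. If \<open>x\<close> is
  \<open>r\<close> or on the leg of \<open>y\<close>, the depths differ and all other legs, at least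
  two, resolve. Otherwise the leg of \<open>x\<close> resolves, together with the leg of
  \<open>y\<close> if the depths agree and a third leg if not.\<close>

lemma two_legs_subset_resolving_set:
  assumes "x \<in> V" "y \<in> V" "x \<noteq> y"
  shows "\<exists>u w. leaf T u \<and> leaf T w \<and> u \<noteq> w \<and> leg u \<union> leg w \<subseteq> resolving_set T x y"
  using assms
proof (induct "d r x" "d r y" arbitrary: x y rule: linorder_wlog)
  case sym
  then show ?case by (metis resolving_set_commute)
next
  case le
  have "y \<noteq> r" using le by auto
  then obtain w where w: "leaf T w" "y \<in> leg w" using leg_cover le by blast
  have dy: "1 \<le> d r y" using depth_pos le \<open>y \<noteq> r\<close> by blast
  show ?case
  proof (cases "x = r \<or> x \<in> leg w")
    case True
    obtain t where t: "leaf T t" "t \<noteq> w" using ex_third_leaf by blast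
    obtain t' where t': "leaf T t'" "t' \<noteq> w" "t' \<noteq> t" using ex_third_leaf by blast
    have ne: "d r x \<noteq> d r y"
    proof (cases "x = r")
      case False
      then show ?thesis using branch_depth_inj[of x y] True w le by (auto simp: leg_def)
    qed (use dy in simp)
    have "leg t \<subseteq> resolving_set T x y" "leg t' \<subseteq> resolving_set T x y"
      using other_leg_resolves[OF w(1) w(1) _ _ _ True _ ne] t t' w by blast+
    then show ?thesis using t t' by blast
  next
    case False
    then obtain u where u: "leaf T u" "x \<in> leg u" using leg_cover le by blast
    then have "u \<noteq> w" using False by blast
    have 1: "leg u \<subseteq> resolving_set T x y"
      using own_leg_resolves u w \<open>u \<noteq> w\<close> le by blast
    show ?thesis
    proof (cases "d r x = d r y")
      case True
      then have "leg w \<subseteq> resolving_set T x y"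
        using own_leg_resolves[of w u y x] resolving_set_commute u w \<open>u \<noteq> w\<close> by force
      then show ?thesis using 1 u w \<open>u \<noteq> w\<close> by blast
    next
      case False
      obtain t where t: "leaf T t" "t \<noteq> u" "t \<noteq> w" using ex_third_leaf by blast
      then have "leg t \<subseteq> resolving_set T x y"
        using other_leg_resolves[OF u(1) w(1)] u w False by blast
      then show ?thesis using 1 u t by blast
    qed
  qed
qed

text \<open>The witnesses are the neighbours of \<open>r\<close> on the two legs: both have depth
  one, so everything off these legs is equally far from them.\<close>

lemma two_legs_eq_resolving_set:
  assumes "leaf T u" "leaf T w" "u \<noteq> w"
  shows "\<exists>x \<in> V. \<exists>y \<in> V. x \<noteq> y \<and> resolving_set T x y = leg u \<union> leg w"
proof -
  have br: "branch t \<in> leg t" "d r (branch t) = 1" if "leaf T t" for t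
  proof -
    have arc: "(r, branch t) \<in> parcs T" using branch_root_arc leaf_in_V leaf_neq_root that by blast
    then show "d r (branch t) = 1" using gdist_arc by blast
    show "branch t \<in> leg t"
      using branch_nbr_root[OF arc] in_arcsD2[OF arc] no_loops'[OF arc] by (simp add: leg_def)
  qed
  let ?x = "branch u" and ?y = "branch w"
  have V: "?x \<in> V" "?y \<in> V" using br assms leg_subset_V by blast+
  have "?x \<noteq> ?y" using leaf_branch_inj assms by blast
  \<comment> \<open>Equal depths allow \<open>own_leg_resolves\<close> in both orders.\<close>
  moreover have "leg u \<subseteq> resolving_set T ?x ?y" "leg w \<subseteq> resolving_set T ?y ?x"
    using own_leg_resolves br assms by simp_all
  moreover have "d ?x z = d ?y z" if "z \<in> V" "z \<notin> leg u \<union> leg w" for z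
  proof (cases "z = r")
    case True
    then show ?thesis using br assms V gdist_sym[of _ r] by simp
  next
    case False
    then obtain t where t: "leaf T t" "z \<in> leg t" using leg_cover \<open>z \<in> V\<close> by blast
    then have "d ?x z = 1 + d r z" "d ?y z = 1 + d r z"
      using gdist_other_leg[of u t ?x z] gdist_other_leg[of w t ?y z] br assms that by auto
    then show ?thesis by simp
  qed
  ultimately have "?x \<noteq> ?y" "resolving_set T ?x ?y = leg u \<union> leg w"
    using resolving_set_commute[of T ?x ?y] by (auto simp: resolving_set_def)
  then show ?thesis using V by blast
qed

text \<open>A resolving set contains two disjoint legs, and the union of the two shortest legs is
  itself a resolving set.\<close>

lemma kappa_eq:
  assumes "leaf T u" "leaf T w" "u \<noteq> w"
    and "\<And>t. leaf T t \<Longrightarrow> d r u \<le> d r t"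
    and "\<And>t. leaf T t \<Longrightarrow> t \<noteq> u \<Longrightarrow> d r w \<le> d r t"
  shows "kappa T = d r u + d r w"
proof -
  let ?K = "{card (resolving_set T x y) |x y. x \<in> V \<and> y \<in> V \<and> x \<noteq> y}"
  have card_Un: "card (leg t \<union> leg t') = d r t + d r t'"
    if "leaf T t" "leaf T t'" "t \<noteq> t'" for t t'
    using that leg_Int_empty card_leg by (simp add: card_Un_disjoint)
  have "?K \<subseteq> (\<lambda>(x, y). card (resolving_set T x y)) ` (V \<times> V)" by auto
  then have "finite ?K"
    by (rule finite_subset) (simp add: pair_finite_verts)
  moreover have "d r u + d r w \<in> ?K"
  proof -
    obtain x y where "x \<in> V" "y \<in> V" "x \<noteq> y" "resolving_set T x y = leg u \<union> leg w"
      using two_legs_eq_resolving_set[OF assms(1-3)] by blast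
    then show ?thesis unfolding mem_Collect_eq using card_Un[OF assms(1-3)] by metis
  qed
  moreover have "d r u + d r w \<le> m" if m: "m \<in> ?K" for m
  proof -
    obtain x y where xy: "m = card (resolving_set T x y)" "x \<in> V" "y \<in> V" "x \<noteq> y"
      using m by blast
    then obtain t t' where t: "leaf T t" "leaf T t'" "t \<noteq> t'"
      "leg t \<union> leg t' \<subseteq> resolving_set T x y"
      using two_legs_subset_resolving_set by meson
    have "finite (resolving_set T x y)" by (simp add: resolving_set_def pair_finite_verts)
    then have "d r t + d r t' \<le> m" using card_mono[OF _ t(4)] card_Un t xy by simp
    \<comment> \<open>If \<open>t = u\<close>, then \<open>t'\<close> is another leaf and is
      compared with \<open>w\<close>; otherwise \<open>t\<close> is compared with \<open>w\<close>
      and \<open>t'\<close> with \<open>u\<close>.\<close>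
    moreover have "d r u + d r w \<le> d r t + d r t'"
    proof (cases "t = u")
      case True
      then show ?thesis using assms(5)[of t'] t by simp
    next
      case False
      then show ?thesis using assms(4)[of t'] assms(5)[of t] t by simp
    qed
    ultimately show ?thesis by simp
  qed
  ultimately show ?thesis unfolding kappa_def by (intro Min_eqI) auto
qed

section \<open>Reduction to leg weights\<close>

text \<open>Unions of two legs occur as resolving sets, and every resolving set contains such a
  union, whose weight is no larger because \<open>g\<close> is nonnegative.\<close>

lemma k_resolving_function_iff:
  "k_resolving_function T k g \<longleftrightarrow>
    (\<forall>x\<in>V. g x \<in> {0..1}) \<and>
    (\<forall>u w. leaf T u \<longrightarrow> leaf T w \<longrightarrow> u \<noteq> w \<longrightarrow> k \<le> sum g (leg u) + sum g (leg w))"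
proof -
  have Un: "sum g (leg u \<union> leg w) = sum g (leg u) + sum g (leg w)"
    if "leaf T u" "leaf T w" "u \<noteq> w" for u w
    using that leg_Int_empty by (simp add: sum.union_disjoint)
  show ?thesis
  proof (intro iffI conjI allI impI)
    assume L: "k_resolving_function T k g"
    then show "\<forall>x\<in>V. g x \<in> {0..1}" by (simp add: k_resolving_function_def)
    fix u w assume uw: "leaf T u" "leaf T w" "u \<noteq> w"
    obtain x y where "x \<in> V" "y \<in> V" "x \<noteq> y" "resolving_set T x y = leg u \<union> leg w"
      using two_legs_eq_resolving_set[OF uw] by blast
    then have "k \<le> sum g (leg u \<union> leg w)" using L by (metis k_resolving_function_def)
    then show "k \<le> sum g (leg u) + sum g (leg w)" using Un[OF uw] by simp
  next
    assume R: "(\<forall>x\<in>V. g x \<in> {0..1}) \<and>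
      (\<forall>u w. leaf T u \<longrightarrow> leaf T w \<longrightarrow> u \<noteq> w \<longrightarrow> k \<le> sum g (leg u) + sum g (leg w))"
    have "k \<le> sum g (resolving_set T x y)" if xy: "x \<in> V" "y \<in> V" "x \<noteq> y" for x y
    proof -
      obtain u w where uw: "leaf T u" "leaf T w" "u \<noteq> w"
        "leg u \<union> leg w \<subseteq> resolving_set T x y"
        using two_legs_subset_resolving_set[OF xy] by blast
      have "k \<le> sum g (leg u) + sum g (leg w)" using R uw(1-3) by blast
      also have "\<dots> = sum g (leg u \<union> leg w)" using Un[OF uw(1-3)] by simp
      also have "\<dots> \<le> sum g (resolving_set T x y)"
      proof (rule sum_mono2[OF _ uw(4)])
        have sub: "resolving_set T x y \<subseteq> V" by (auto simp: resolving_set_def)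
        then show "finite (resolving_set T x y)" by (rule finite_subset[OF _ pair_finite_verts])
        show "0 \<le> g z" if "z \<in> resolving_set T x y - (leg u \<union> leg w)" for z
        proof -
          have "g z \<in> {0..1}" using R sub that by blast
          then show ?thesis by simp
        qed
      qed
      finally show ?thesis .
    qed
    then show "k_resolving_function T k g" unfolding k_resolving_function_def using R by blast
  qed
qed

lemma sum_V_eq:
  fixes g :: "'a \<Rightarrow> real"
  shows "sum g V = g r + (\<Sum>u\<in>leaves. sum g (leg u))"
proof -
  have V: "V = insert r (\<Union>u\<in>leaves. leg u)"
  proof (intro subset_antisym subsetI)
    fix x assume "x \<in> V"
    then show "x \<in> insert r (\<Union>u\<in>leaves. leg u)" using leg_cover[of x] by blast
  qed (use leg_subset_V in auto)
  moreover have "r \<notin> (\<Union>u\<in>leaves. leg u)" by (auto simp: leg_def)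
  moreover have "sum g (\<Union>u\<in>leaves. leg u) = (\<Sum>u\<in>leaves. sum g (leg u))"
    by (rule sum.UNION_disjoint) (auto dest: leg_Int_empty)
  moreover have "finite (\<Union>u\<in>leaves. leg u)" by simp
  ultimately show ?thesis by (subst V) simp
qed

text \<open>Only the total weight of each leg matters: the fractional dimension is the value of a linear
  program with one variable per leaf.\<close>

lemma frac_metric_dim_eqI:
  fixes s :: "'a \<Rightarrow> real"
  assumes "\<And>u. leaf T u \<Longrightarrow> 0 \<le> s u \<and> s u \<le> real (d r u)"
    and "\<And>u w. leaf T u \<Longrightarrow> leaf T w \<Longrightarrow> u \<noteq> w \<Longrightarrow> k \<le> s u + s w"
    and "sum s leaves = M"
    and min: "\<And>s'. (\<And>u. leaf T u \<Longrightarrow> s' u \<le> real (d r u)) \<Longrightarrow>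
      (\<And>u w. leaf T u \<Longrightarrow> leaf T w \<Longrightarrow> u \<noteq> w \<Longrightarrow> k \<le> s' u + s' w) \<Longrightarrow> M \<le> sum s' leaves"
  shows "frac_metric_dim T k = M"
  unfolding frac_metric_dim_def
proof (rule Least_equality)
  \<comment> \<open>\<open>tip x\<close> is the leaf of the leg through \<open>x\<close>. The weight
    \<open>s u\<close> is spread evenly over the \<open>d r u\<close> vertices of its leg, so values
    stay at most 1; \<open>r\<close> gets 0.\<close>
  define tip where "tip x = (THE u. leaf T u \<and> x \<in> leg u)" for x
  define g where "g x = (if x = r then 0 else s (tip x) / real (d r (tip x)))" for x
  have tip: "tip x = u" if "leaf T u" "x \<in> leg u" for x u
    unfolding tip_def using that leg_disjoint by blast
  have g_leg: "g x = s u / real (d r u)" if "leaf T u" "x \<in> leg u" for x u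
    using that tip by (auto simp: g_def leg_def)
  have sum_leg: "sum g (leg u) = s u" if "leaf T u" for u
    using g_leg card_leg leaf_depth_pos[of u] that by simp
  have "g x \<in> {0..1}" if "x \<in> V" for x
  proof (cases "x = r")
    case False
    then obtain u where u: "leaf T u" "x \<in> leg u" using leg_cover \<open>x \<in> V\<close> by blast
    then show ?thesis using g_leg[OF u] assms(1)[of u] leaf_depth_pos[of u] by simp
  qed (simp add: g_def)
  then have "k_resolving_function T k g"
    using assms(2) sum_leg by (simp add: k_resolving_function_iff)
  moreover have "sum g V = M"
    using assms(3) sum_leg by (simp add: sum_V_eq g_def[of r])
  ultimately show "\<exists>g. k_resolving_function T k g \<and> M = sum g V" by blast
next
  fix m assume "\<exists>g. k_resolving_function T k g \<and> m = sum g V"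
  then obtain g where g: "k_resolving_function T k g" "m = sum g V" by blast
  \<comment> \<open>The leg totals of \<open>g\<close> are feasible, since \<open>g\<close> is at
    most 1 on each vertex; the weight of \<open>r\<close> can only add to them.\<close>
  have "M \<le> (\<Sum>u\<in>leaves. sum g (leg u))"
  proof (rule min)
    fix u assume "leaf T u"
    then show "sum g (leg u) \<le> real (d r u)"
      using sum_bounded_above[of "leg u" g 1] g(1) leg_subset_V card_leg
      by (force simp: k_resolving_function_iff)
  qed (use g(1) in \<open>simp add: k_resolving_function_iff\<close>)
  moreover have "0 \<le> g r" using g(1) root_in_V by (simp add: k_resolving_function_iff)
  ultimately show "M \<le> m" using g(2) sum_V_eq[of g] by linarith
qed

section \<open>Optimal leg weights\<close>

text \<open>Weight \<open>k / 2\<close> fits on every leg because it fits on the shortest, and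
  \<open>half_sum_lower_bound\<close> shows it to be optimal.\<close>

lemma frac_metric_dim_small:
  assumes "leaf T u" "\<And>t. leaf T t \<Longrightarrow> d r u \<le> d r t" "0 \<le> k" "k \<le> 2 * real (d r u)"
  shows "frac_metric_dim T k = k * real (card leaves) / 2"
proof (rule frac_metric_dim_eqI)
  show "0 \<le> k / 2 \<and> k / 2 \<le> real (d r t)" if "leaf T t" for t
    using assms(2)[OF that] assms(3,4) by linarith
  show "k * real (card leaves) / 2 \<le> sum s' leaves"
    if "\<And>u w. leaf T u \<Longrightarrow> leaf T w \<Longrightarrow> u \<noteq> w \<Longrightarrow> k \<le> s' u + s' w" for s'
    using that card_leaves_ge_3 by (intro half_sum_lower_bound) auto
qed simp_all

text \<open>The shortest leg is filled completely and all others get the remaining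
  \<open>k - d r u\<close>. Two of these suffice for \<open>k\<close> because
  \<open>2 * d r u \<le> k\<close>.\<close>

lemma frac_metric_dim_large:
  assumes "leaf T u" "\<And>t. leaf T t \<Longrightarrow> t \<noteq> u \<Longrightarrow> k - real (d r u) \<le> real (d r t)"
    and "2 * real (d r u) \<le> k"
  shows "frac_metric_dim T k
    = (real (card leaves) - 1) * k - (real (card leaves) - 2) * real (d r u)" (is "_ = ?M")
proof (rule frac_metric_dim_eqI)
  let ?s = "\<lambda>t. if t = u then real (d r u) else k - real (d r u)"
  show "0 \<le> ?s t \<and> ?s t \<le> real (d r t)" if "leaf T t" for t
    using assms(2)[OF that] assms(3) by auto
  show "k \<le> ?s t + ?s t'" if "t \<noteq> t'" for t t'
    using that assms(3) by auto
  have "real (card (leaves - {u})) = real (card leaves) - 1"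
    using assms(1) card_leaves_ge_3 by simp
  then show "sum ?s leaves = ?M"
    using sum.remove[of leaves u ?s] assms(1) by (simp add: algebra_simps)
  show "?M \<le> sum s' leaves"
    if s': "\<And>u. leaf T u \<Longrightarrow> s' u \<le> real (d r u)"
      "\<And>u w. leaf T u \<Longrightarrow> leaf T w \<Longrightarrow> u \<noteq> w \<Longrightarrow> k \<le> s' u + s' w" for s'
  proof -
    have "(real (card leaves) - 1) * k - (real (card leaves) - 2) * s' u \<le> sum s' leaves"
      using s'(2) assms(1) by (intro sum_lower_bound) auto
    \<comment> \<open>The lower bound at \<open>u\<close> is smallest when \<open>s' u\<close>
      reaches the length of the leg.\<close>
    moreover have "(real (card leaves) - 2) * s' u \<le> (real (card leaves) - 2) * real (d r u)"
      using s'(1) assms(1) card_leaves_ge_3 by (intro mult_left_mono) auto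
    ultimately show ?thesis by linarith
  qed
qed

text \<open>Only the range of \<open>k\<close> separates the two formulas. If the two shortest legs
  have equal length, then \<open>kappa T = 2 * d r (l 1)\<close> and the second range is
  empty.\<close>

lemma fractional_dimension_of_spider:
  fixes l :: "nat \<Rightarrow> 'a" and a :: nat
  assumes l: "bij_betw l {1..a} leaves"
    and sorted: "\<forall>i j. 1 \<le> i \<and> i \<le> j \<and> j \<le> a \<longrightarrow> d r (l i) \<le> d r (l j)"
  shows "3 \<le> a" "kappa T = d (l 1) (l 2)" "kappa T = d r (l 1) + d r (l 2)" "1 \<le> d r (l 1)"
    and "\<And>k. 1 \<le> k \<Longrightarrow> k \<le> 2 * real (d r (l 1)) \<Longrightarrow> frac_metric_dim T k = k * real a / 2"
    and "\<And>k. 2 * real (d r (l 1)) < k \<Longrightarrow> k \<le> real (kappa T) \<Longrightarrow>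
      frac_metric_dim T k = (real a - 1) * k - (real a - 2) * real (d r (l 1))"
proof -
  have a: "card leaves = a" using bij_betw_same_card[OF l] by simp
  then show "3 \<le> a" using card_leaves_ge_3 by simp
  have leaf: "leaf T (l i)" if "i \<in> {1..a}" for i
    using bij_betwE[OF l] that by blast
  have ex_index: "\<exists>i \<in> {1..a}. l i = t" if "leaf T t" for t
  proof -
    have "t \<in> l ` {1..a}" using bij_betw_imp_surj_on[OF l] that by simp
    then show ?thesis by blast
  qed
  have l1: "leaf T (l 1)" and l2: "leaf T (l 2)" using leaf \<open>3 \<le> a\<close> by simp_all
  have ne: "l 1 \<noteq> l 2"
    using inj_onD[OF bij_betw_imp_inj_on[OF l], of 1 2] \<open>3 \<le> a\<close> by auto
  have min1: "d r (l 1) \<le> d r t" if "leaf T t" for t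
    using ex_index[OF that] sorted by auto
  have min2: "d r (l 2) \<le> d r t" if t: "leaf T t" "t \<noteq> l 1" for t
  proof -
    obtain i where i: "i \<in> {1..a}" "l i = t" using ex_index t by blast
    then have "2 \<le> i" using t(2) by (cases "i = 1") auto
    then show ?thesis using sorted i by auto
  qed
  show kappa: "kappa T = d r (l 1) + d r (l 2)"
    using kappa_eq[OF l1 l2 ne] min1 min2 by blast
  have "l 1 \<in> leg (l 1)" "l 2 \<in> leg (l 2)"
    using l1 l2 leaf_in_V leaf_neq_root by (simp_all add: leg_def)
  then show "kappa T = d (l 1) (l 2)"
    using gdist_distinct_legs[OF l1 l2 ne] kappa by presburger
  show "1 \<le> d r (l 1)" using leaf_depth_pos[OF l1] .
  show "frac_metric_dim T k = k * real a / 2" if "1 \<le> k" "k \<le> 2 * real (d r (l 1))" for k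
    using frac_metric_dim_small[OF l1 min1 _ that(2)] that(1) a by simp
  show "frac_metric_dim T k = (real a - 1) * k - (real a - 2) * real (d r (l 1))"
    if k: "2 * real (d r (l 1)) < k" "k \<le> real (kappa T)" for k
  proof -
    \<comment> \<open>The bound \<open>k \<le> kappa T\<close> is what makes the remaining weight
      fit on the second shortest leg, hence on all longer ones.\<close>
    have "k - real (d r (l 1)) \<le> real (d r t)" if "leaf T t" "t \<noteq> l 1" for t
      using min2[OF that] k(2) kappa by linarith
    then show ?thesis using frac_metric_dim_large[OF l1, of k] k(1) a by simp
  qed
qed

end

text \<open>A major vertex other than \<open>v\<close> would yield, with \<open>v\<close> as root,
  an exterior major vertex other than \<open>v\<close>.\<close>

lemma spider_if_ex_major_1:
  assumes "undirected_tree T" "ex_major T = 1" "exterior_major_vertex T v"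
  shows "spider T v"
proof -
  have v: "major_vertex T v" using assms(3) by (simp add: exterior_major_vertex_def)
  then have rooted: "rooted_tree T v"
    using assms(1)
    by (intro rooted_tree.intro finite_tree.intro rooted_tree_axioms.intro) (simp_all add: major_vertex_def)
  obtain z where "{w. exterior_major_vertex T w} = {z}"
    using assms(2) card_1_singletonE[of "{w. exterior_major_vertex T w}"]
    by (auto simp: ex_major_def)
  then have "w = v" if "exterior_major_vertex T w" for w
    using assms(3) that by (metis mem_Collect_eq singletonD)
  then have "w = v" if "major_vertex T w" for w
    using rooted_tree.ex_exterior_major_vertex[OF rooted that] by blast
  then show ?thesis using v rooted by (intro spider.intro spider_axioms.intro)
qed

theorem proposition4p3:
  fixes T :: "'a pair_pre_digraph" and v :: 'a and l :: "nat \<Rightarrow> 'a" and a :: nat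
  assumes "undirected_tree T"
    and "ex_major T = 1"
    and "exterior_major_vertex T v"
    and "bij_betw l {1..a} {u. terminal_vertex T v u}"
    and "\<forall>i j. 1 \<le> i \<and> i \<le> j \<and> j \<le> a \<longrightarrow> gdist T v (l i) \<le> gdist T v (l j)"
  shows "a \<ge> 3 \<and>
    kappa T = gdist T (l 1) (l 2) \<and>
    (gdist T v (l 1) = gdist T v (l 2) \<longrightarrow>
      (\<forall>k::real. k \<in> {1..real (kappa T)} \<longrightarrow>
        frac_metric_dim T k = k * frac_metric_dim T 1 \<and>
        k * frac_metric_dim T 1 = k * real a / 2)) \<and>
    (gdist T v (l 1) < gdist T v (l 2) \<longrightarrow>
      (\<forall>k::real. k \<in> {1..2 * real (gdist T v (l 1))} \<longrightarrow>
        frac_metric_dim T k = k * real a / 2) \<and>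
      (\<forall>k::real. k \<in> {2 * real (gdist T v (l 1))<..real (kappa T)} \<longrightarrow>
        frac_metric_dim T k = (real a - 1) * k - (real a - 2) * real (gdist T v (l 1))))"
proof -
  have spider: "spider T v" using spider_if_ex_major_1[OF assms(1-3)] .
  have l: "bij_betw l {1..a} {u. leaf T u}"
    using assms(4) by (simp add: spider.terminal_iff_leaf[OF spider])
  note fd = spider.fractional_dimension_of_spider[OF spider l assms(5)]
  have one: "frac_metric_dim T 1 = real a / 2" using fd(4) fd(5)[of 1] by simp
  have a: "frac_metric_dim T k = k * frac_metric_dim T 1 \<and>
      k * frac_metric_dim T 1 = k * real a / 2"
    if "gdist T v (l 1) = gdist T v (l 2)" "1 \<le> k" "k \<le> real (kappa T)" for k
  proof -
    \<comment> \<open>Equal shortest legs give \<open>kappa T = 2 * d(v, l 1)\<close>, so the first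
      formula covers all admissible \<open>k\<close>.\<close>
    have "k \<le> 2 * real (gdist T v (l 1))" using fd(3) that by linarith
    then show ?thesis using fd(5)[OF that(2)] unfolding one by simp
  qed
  show ?thesis
  proof (intro conjI impI allI)
    show "3 \<le> a" "kappa T = gdist T (l 1) (l 2)" by (fact fd)+
  next
    fix k :: real
    assume "gdist T v (l 1) = gdist T v (l 2)" "k \<in> {1..real (kappa T)}"
    then show "frac_metric_dim T k = k * frac_metric_dim T 1"
      "k * frac_metric_dim T 1 = k * real a / 2"
      using a[of k] by simp_all
  next
    fix k :: real
    assume "k \<in> {1..2 * real (gdist T v (l 1))}"
    then show "frac_metric_dim T k = k * real a / 2" using fd(5)[of k] by simp
  next
    fix k :: real
    assume "k \<in> {2 * real (gdist T v (l 1))<..real (kappa T)}"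
    then show "frac_metric_dim T k = (real a - 1) * k - (real a - 2) * real (gdist T v (l 1))"
      using fd(6)[of k] by simp
  qed
qed

end
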